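(* Let $V$ be a finite-dimensional vector space over a finite field $\mathbb{F}_q$, let $\Gamma=(\mathcal{P},\mathcal{L})$ be a point-line geometry and let $\varepsilon:\Gamma\to\mathrm{PG}(V)$ be a projective embedding of $\Gamma$. If for every hyperplane $H$ of $\mathrm{PG}(V)$ the graph induced by the collinearity graph of $\Gamma$ on $\mathcal{P}\setminus\varepsilon^{-1}(H)$ is connected, then the projective code $\mathcal{C}(\varepsilon(\mathcal{P}))$ is minimal.
   Context: A point-line geometry is a pair $\Gamma=(\mathcal{P},\mathcal{L})$ where $\mathcal{P}$ is a non-empty set (points) and $\mathcal{L}$ is a set of subsets of $\mathcal{P}$ (lines) such that every line contains at least two points and any two distinct points lie in at most one common line. The collinearity graph of $\Gamma$ has vertex set $\mathcal{P}$, two distinct points being adjacent if and only if they lie on a common line. A projective embedding $\varepsilon:\Gamma\to\mathrm{PG}(V)$ is an injective map from $\mathcal{P}$ to the set of points of $\mathrm{PG}(V)$ which maps every line of $\Gamma$ onto a (full) projective line of $\mathrm{PG}(V)$ and such that $\varepsilon(\mathcal{P})$ spans $\mathrm{PG}(V)$. For a hyperplane $H$ of $\mathrm{PG}(V)$, $\varepsilon^{-1}(H)=\{p\in\mathcal{P}:\varepsilon(p)\in H\}$. Given a set $\Omega$ of $N$ distinct points spanning $\mathrm{PG}(V)$, with $\dim V=k$ (a projective system), $\mathcal{C}(\Omega)$ denotes the $[N,k]$-linear code over $\mathbb{F}_q$ having as generator matrix a $k\times N$ matrix whose columns are coordinate vectors (with respect to a fixed basis of $V$) of representatives of the points of $\Omega$;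 it is defined up to monomial equivalence and is called a projective code. For a codeword $c=(c_i)_{i=1}^N$ put $\mathrm{supp}(c)=\{i: c_i\neq 0\}$. A linear code $\mathcal{C}$ over $\mathbb{F}_q$ is minimal if for every non-zero $c\in\mathcal{C}$ and every $c'\in\mathcal{C}$ with $\mathrm{supp}(c')\subseteq\mathrm{supp}(c)$ there is $\lambda\in\mathbb{F}_q$ with $c'=\lambda c$. *)

theory Defs
  imports "Jordan_Normal_Form.VS_Connect" "Graph_Theory.Graph_Theory"
begin

locale point_line_geometry =
  fixes P :: "'p set" and L :: "'p set set"
  assumes points_nonempty: "P \<noteq> {}"
    and lines_subset: "l \<in> L \<Longrightarrow> l \<subseteq> P"
    and line_two_points: "l \<in> L \<Longrightarrow> \<exists>x\<in>l. \<exists>y\<in>l. x \<noteq> y"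
    and line_unique: "\<lbrakk>l \<in> L; m \<in> L; x \<in> l; y \<in> l; x \<in> m; y \<in> m; x \<noteq> y\<rbrakk> \<Longrightarrow> l = m"

text \<open>The collinearity graph as a symmetric loop-free digraph: each edge is a pair of opposite arcs.\<close>

definition collinearity_graph :: "'p set \<Rightarrow> 'p set set \<Rightarrow> ('p, 'p \<times> 'p) pre_digraph" where
  "collinearity_graph P L =
     \<lparr>verts = P,
      arcs = {(x, y). x \<in> P \<and> y \<in> P \<and> x \<noteq> y \<and> (\<exists>l\<in>L. x \<in> l \<and> y \<in> l)},
      tail = fst, head = snd\<rparr>"

text \<open>
  A point of PG(V) is a one-dimensional linear subspace of V. Lines and hyperplanes of PG(V) are
  represented by the sets of points they contain; here V is the whole type \<^typ>\<open>'b\<close>.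
\<close>

locale projective_space = vector_space scale
  for scale :: "'a::field \<Rightarrow> 'b::ab_group_add \<Rightarrow> 'b"
begin

definition pg_points :: "'b set set" where
  "pg_points = {U. subspace U \<and> dim U = 1}"

definition pg_subspace :: "'b set \<Rightarrow> 'b set set" where
  "pg_subspace U = {p \<in> pg_points. p \<subseteq> U}"

definition pg_lines :: "'b set set set" where
  "pg_lines = pg_subspace ` {U. subspace U \<and> dim U = 2}"

definition pg_hyperplanes :: "'b set set set" where
  "pg_hyperplanes = pg_subspace ` {U. subspace U \<and> dim U + 1 = dim UNIV}"

definition projective_embedding :: "'p set \<Rightarrow> 'p set set \<Rightarrow> ('p \<Rightarrow> 'b set) \<Rightarrow> bool" where
  "projective_embedding P L \<epsilon> \<longleftrightarrow>
     \<epsilon> ` P \<subseteq> pg_points \<and> inj_on \<epsilon> P \<and> (\<forall>l\<in>L. \<epsilon> ` l \<in> pg_lines) \<and> span (\<Union>(\<epsilon> ` P)) = UNIV"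

text \<open>
  A list containing exactly one representative vector of each point in \<open>\<Omega>\<close>; the order of the
  list is the order of the coordinate positions of the code.
\<close>

definition representatives :: "'b set set \<Rightarrow> 'b list \<Rightarrow> bool" where
  "representatives \<Omega> vs \<longleftrightarrow>
     0 \<notin> set vs \<and> distinct (map (\<lambda>v. span {v}) vs) \<and> set (map (\<lambda>v. span {v}) vs) = \<Omega>"

definition generator_matrix :: "'b list \<Rightarrow> 'b list \<Rightarrow> 'a mat" where
  "generator_matrix bs vs =
     mat (length bs) (length vs) (\<lambda>(i, j). representation (set bs) (vs ! j) (bs ! i))"

text \<open>
  The choice of the basis \<open>bs\<close> does not affect the code; another choice of the representatives
  \<open>vs\<close> changes it by a monomial equivalence.
\<close>

definition projective_code :: "'b list \<Rightarrow> 'b list \<Rightarrow> 'a vec set" where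
  "projective_code bs vs =
     vec_space.row_space (length vs) (generator_matrix bs vs)"

end

definition linear_code :: "nat \<Rightarrow> 'a::field vec set \<Rightarrow> bool" where
  "linear_code N C \<longleftrightarrow> VectorSpace.subspace class_ring C (module_vec TYPE('a) N)"

definition supp :: "'a::zero vec \<Rightarrow> nat set" where
  "supp c = {i. i < dim_vec c \<and> c $ i \<noteq> 0}"

definition minimal_code :: "nat \<Rightarrow> 'a::field vec set \<Rightarrow> bool" where
  "minimal_code N C \<longleftrightarrow>
     linear_code N C \<and>
     (\<forall>c\<in>C. \<forall>c'\<in>C. c \<noteq> 0\<^sub>v N \<and> supp c' \<subseteq> supp c \<longrightarrow> (\<exists>a. c' = a \<cdot>\<^sub>v c))"

end

theory Submission
  imports Defs
begin

text \<open>
  Fix a non-zero codeword \<open>c\<close> and a codeword \<open>c'\<close> whose support is contained in that of \<open>c\<close>.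
  Codewords are the evaluations of linear functionals of \<open>V\<close> on the representatives of the points
  of the projective system (\<open>projective_code_functional\<close>), so \<open>c\<close> and \<open>c'\<close> come from functionals
  \<open>f \<noteq> 0\<close> and \<open>g\<close>, and the inclusion of supports says that \<open>g\<close> vanishes on every point
  \<open>\<epsilon> p\<close> on which \<open>f\<close> vanishes.

  The kernel of \<open>f\<close> is a hyperplane, and on a point outside it the ratio \<open>g / f\<close> is well defined.
  The claim is that this ratio does not change along an edge of the collinearity graph. If \<open>x\<close> and
  \<open>y\<close> represent two collinear points outside the hyperplane, then \<open>w = f y \<cdot> x - f x \<cdot> y\<close> lies on
  the projective line through them and satisfies \<open>f w = 0\<close>. As the embedding maps a line of the
  geometry onto a full projective line, the point spanned by \<open>w\<close> is the image of a point of the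
  geometry; hence also \<open>g w = 0\<close>, which reads \<open>f y \<cdot> g x = f x \<cdot> g y\<close>. This is
  \<open>cross_multiplied_eq\<close> together with \<open>vanishing_on_line\<close>.

  Since the graph outside the hyperplane is connected, \<open>g / f\<close> has the same value \<open>a\<close> at all of its
  vertices, so \<open>g = a f\<close> on every point outside the hyperplane; inside it both functionals vanish.
  Therefore \<open>c' = a c\<close>.
\<close>

text \<open>
  The library defines connectedness through the symmetric closure of the graph, so the invariant
  \<open>Q\<close> has to be carried along an arc in either direction.
\<close>

lemma connected_invariant:
  assumes "connected G" "u \<in> verts G" "v \<in> verts G" "Q u"
    and step: "\<And>e. e \<in> arcs G \<Longrightarrow> tail G e \<in> verts G \<Longrightarrow> head G e \<in> verts G \<Longrightarrow>
      Q (tail G e) \<longleftrightarrow> Q (head G e)"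
  shows "Q v"
proof -
  have "u \<rightarrow>\<^sup>*\<^bsub>with_proj (mk_symmetric G)\<^esub> v"
    using assms(1-3) by (auto simp: connected_def strongly_connected_def)
  then have "(u, v) \<in> rtrancl_on (verts G) (parcs (mk_symmetric G))"
    by (simp add: reachable_def)
  then show ?thesis
    using \<open>Q u\<close>
  proof (induction rule: rtrancl_on_induct)
    case (step y z)
    then show ?case
      using assms(5) by (auto simp: parcs_mk_symmetric)
  qed simp
qed

lemma linear_code_row_space:
  "linear_code (dim_col A) (vec_space.row_space (dim_col A) A)"
proof -
  interpret vec_space "TYPE('a)" "dim_col A" .
  show ?thesis
    unfolding linear_code_def row_space_def
    by (rule span_is_subspace) (use rows_carrier[of A] in auto)
qed

locale finite_dimensional_projective_space =
  finite_dimensional_vector_space scale Basis + projective_space scale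
  for scale :: "'a::field \<Rightarrow> 'b::ab_group_add \<Rightarrow> 'b" and Basis :: "'b set"
begin

abbreviation functional :: "('b \<Rightarrow> 'a) \<Rightarrow> bool" where
  "functional \<equiv> Vector_Spaces.linear scale (*)"

lemma functional_simps:
  assumes "functional f"
  shows "f (x + y) = f x + f y" "f (x - y) = f x - f y" "f (scale a x) = a * f x" "f 0 = 0"
proof -
  interpret f: Vector_Spaces.linear scale "(*)" f by (fact assms)
  show "f (x + y) = f x + f y" "f (x - y) = f x - f y" "f (scale a x) = a * f x" "f 0 = 0"
    by (simp_all add: f.add f.diff f.scale f.zero)
qed

lemma functional_vanishing_span:
  assumes "functional f" "\<And>x. x \<in> S \<Longrightarrow> f x = 0" "v \<in> span S"
  shows "f v = 0"
  using assms(3)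
  by (induction rule: span_induct_alt) (auto simp: functional_simps[OF assms(1)] assms(2))

lemma subspace_kernel: "functional f \<Longrightarrow> subspace {x. f x = 0}"
  by (simp add: subspace_def functional_simps)

lemma span_in_pg_points: "w \<noteq> 0 \<Longrightarrow> span {w} \<in> pg_points"
  by (simp add: pg_points_def dim_insert)

lemma pg_point_eq_span:
  assumes "U \<in> pg_points" "w \<in> U" "w \<noteq> 0"
  shows "U = span {w}"
proof -
  have "span {w} = span U"
    using assms by (intro dim_eq_span) (auto simp: pg_points_def dim_insert)
  moreover have "span U = U"
    using assms(1) by (simp add: pg_points_def)
  ultimately show ?thesis
    by simp
qed

text \<open>
  Any vector \<open>x\<close> outside the kernel spans a complement of it, since \<open>v - (f v / f x) \<cdot> x\<close> lies in
  the kernel for every \<open>v\<close>.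
\<close>

lemma kernel_in_pg_hyperplanes:
  assumes f: "functional f" and x: "f x \<noteq> 0"
  shows "pg_subspace {v. f v = 0} \<in> pg_hyperplanes"
proof -
  let ?K = "{v. f v = 0}"
  have K: "span ?K = ?K"
    using subspace_kernel[OF f] by (simp only: span_eq_iff)
  have "v \<in> span (insert x ?K)" for v
    unfolding span_insert K using x
    by (auto simp: functional_simps[OF f] intro!: exI[of _ "f v / f x"])
  then have "dim (UNIV :: 'b set) = dim (insert x ?K)"
    by (metis UNIV_eq_I dim_span)
  also have "\<dots> = dim ?K + 1"
    using x by (simp add: dim_insert K)
  finally show ?thesis
    using subspace_kernel[OF f] by (auto simp: pg_hyperplanes_def)
qed

text \<open>
  The combination of \<open>x\<close> and \<open>y\<close> that \<open>f\<close> annihilates lies in \<open>W\<close>, so \<open>g\<close> annihilates it too. The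
  equality of the ratios \<open>g / f\<close> at \<open>x\<close> and \<open>y\<close> is written without denominators because these may
  be zero.
\<close>

lemma cross_multiplied_eq:
  assumes f: "functional f" and g: "functional g" and W: "subspace W" "x \<in> W" "y \<in> W"
    and vanish: "\<And>w. w \<in> W \<Longrightarrow> f w = 0 \<Longrightarrow> g w = 0"
  shows "f y * g x = f x * g y"
proof -
  let ?w = "scale (f y) x - scale (f x) y"
  have "?w \<in> W"
    using W by (intro subspace_diff subspace_scale)
  moreover have "f ?w = 0"
    by (simp add: functional_simps[OF f])
  ultimately have "g ?w = 0"
    by (rule vanish)
  then show ?thesis
    by (simp add: functional_simps[OF g])
qed

text \<open>
  The hypothesis \<open>vanish\<close> speaks only of points of the geometry, whereas \<open>cross_multiplied_eq\<close> needs
  all vectors of the plane \<open>W\<close> that carries the line. Fullness of the embedded line bridges the gap: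
  every point of \<open>W\<close> is the image of a point of the geometry.
\<close>

lemma vanishing_on_line:
  assumes emb: "projective_embedding P L \<epsilon>" and l: "l \<in> L" "l \<subseteq> P"
    and f: "functional f" and g: "functional g"
    and vanish: "\<And>p. p \<in> P \<Longrightarrow> \<forall>v\<in>\<epsilon> p. f v = 0 \<Longrightarrow> \<forall>v\<in>\<epsilon> p. g v = 0"
  obtains W where "subspace W" "\<And>p. p \<in> l \<Longrightarrow> \<epsilon> p \<subseteq> W"
    "\<And>w. w \<in> W \<Longrightarrow> f w = 0 \<Longrightarrow> g w = 0"
proof -
  obtain W where W: "subspace W" "\<epsilon> ` l = pg_subspace W"
    using emb l(1) by (auto simp: projective_embedding_def pg_lines_def)
  have "g w = 0" if w: "w \<in> W" "f w = 0" for w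
  proof (cases "w = 0")
    case True
    then show ?thesis
      by (simp add: functional_simps[OF g])
  next
    case False
    have "span {w} \<in> \<epsilon> ` l"
      unfolding W(2) using w(1) W(1) False
      by (simp add: pg_subspace_def span_in_pg_points span_minimal)
    then obtain r where r: "r \<in> P" "\<epsilon> r = span {w}"
      using l(2) by (auto simp: image_iff)
    have "\<forall>v\<in>\<epsilon> r. f v = 0"
      using functional_vanishing_span[OF f, of "{w}"] w(2) r(2) by auto
    then show ?thesis
      using vanish[OF r(1)] r(2) by (auto intro: span_base)
  qed
  moreover have "\<epsilon> p \<subseteq> W" if "p \<in> l" for p
    using W(2) that by (auto simp: pg_subspace_def)
  ultimately show thesis
    using that W(1) by blast
qed

text \<open>
  This is minimality of the code, free of coordinates: \<open>vanish\<close> is the inclusion of supports, and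
  \<open>v0\<close> witnesses that the codeword of \<open>f\<close> is non-zero. The factor \<open>a\<close> is the ratio of the
  functionals at \<open>v0\<close>, carried from there to every other point outside the hyperplane along paths
  of the collinearity graph.
\<close>

lemma functionals_proportional:
  assumes "point_line_geometry P L" and emb: "projective_embedding P L \<epsilon>"
    and conn: "\<And>H. H \<in> pg_hyperplanes \<Longrightarrow>
      connected (collinearity_graph P L \<restriction> (P - {p \<in> P. \<epsilon> p \<in> H}))"
    and f: "functional f" and g: "functional g"
    and p0: "p0 \<in> P" and v0: "v0 \<in> \<epsilon> p0" "f v0 \<noteq> 0"
    and vanish: "\<And>p. p \<in> P \<Longrightarrow> \<forall>v\<in>\<epsilon> p. f v = 0 \<Longrightarrow> \<forall>v\<in>\<epsilon> p. g v = 0"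
  obtains a where "\<And>p v. p \<in> P \<Longrightarrow> v \<in> \<epsilon> p \<Longrightarrow> g v = a * f v"
proof -
  interpret point_line_geometry P L by fact
  define a where "a = g v0 / f v0"
  define D where "D = {p \<in> P. \<exists>v\<in>\<epsilon> p. f v \<noteq> 0}"
  define Q where "Q p \<longleftrightarrow> (\<forall>v\<in>\<epsilon> p. g v = a * f v)" for p
  let ?G = "collinearity_graph P L \<restriction> D"
  have point: "\<epsilon> p \<in> pg_points" if "p \<in> P" for p
    using emb that by (auto simp: projective_embedding_def)
  have "D = P - {p \<in> P. \<epsilon> p \<in> pg_subspace {v. f v = 0}}"
    using point by (auto simp: D_def pg_subspace_def)
  then have conn_D: "connected ?G"
    using conn[OF kernel_in_pg_hyperplanes[OF f v0(2)]] by simp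
  have p0_D: "p0 \<in> D"
    using p0 v0 by (auto simp: D_def)

  have Q_p0: "Q p0"
    unfolding Q_def
  proof
    fix v assume v: "v \<in> \<epsilon> p0"
    have "v0 \<noteq> 0"
      using v0(2) by (auto simp: functional_simps[OF f])
    then have "\<epsilon> p0 = span {v0}"
      using pg_point_eq_span[OF point[OF p0] v0(1)] by simp
    with v obtain c where "v = scale c v0"
      by (auto simp: span_singleton)
    then show "g v = a * f v"
      using v0(2) by (simp add: a_def functional_simps[OF f] functional_simps[OF g])
  qed

  have collinear_step: "Q q" if D: "p \<in> D" and l: "l \<in> L" "p \<in> l" "q \<in> l" and "Q p" for p q l
  proof -
    obtain W where W: "subspace W" "\<epsilon> p \<subseteq> W" "\<epsilon> q \<subseteq> W"
      and W0: "\<And>w. w \<in> W \<Longrightarrow> f w = 0 \<Longrightarrow> g w = 0"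
      using vanishing_on_line[OF emb l(1) lines_subset[OF l(1)] f g vanish] l(2,3) by metis
    obtain x where x: "x \<in> \<epsilon> p" "f x \<noteq> 0"
      using D by (auto simp: D_def)
    have "g x = a * f x"
      using \<open>Q p\<close> x(1) by (simp add: Q_def)
    moreover have "f y * g x = f x * g y" if "y \<in> \<epsilon> q" for y
      using cross_multiplied_eq[OF f g W(1) _ _ W0] x(1) that W(2,3) by blast
    ultimately show ?thesis
      using x(2) by (auto simp: Q_def mult.commute)
  qed

  have "g v = a * f v" if p: "p \<in> P" and v: "v \<in> \<epsilon> p" for p v
  proof (cases "p \<in> D")
    case True
    have "Q p"
    proof (rule connected_invariant[where Q = Q, OF conn_D _ _ Q_p0])
      fix e assume "e \<in> arcs ?G"
      then obtain l where "l \<in> L" "fst e \<in> l" "snd e \<in> l" "fst e \<in> D" "snd e \<in> D"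
        by (auto simp: collinearity_graph_def induce_subgraph_def)
      then have "Q (fst e) \<longleftrightarrow> Q (snd e)"
        using collinear_step by blast
      then show "Q (tail ?G e) \<longleftrightarrow> Q (head ?G e)"
        by (simp add: collinearity_graph_def induce_subgraph_def)
    qed (use p0_D True in simp_all)
    then show ?thesis
      using v by (simp add: Q_def)
  next
    case False
    then have "\<forall>v\<in>\<epsilon> p. f v = 0"
      using p by (simp add: D_def)
    then show ?thesis
      using vanish[OF p] v by simp
  qed
  then show thesis
    by (rule that)
qed

text \<open>
  A combination of the rows of the generator matrix is the same combination of the coordinate
  functionals of the basis, evaluated at the representatives.
\<close>

lemma projective_code_functional:
  assumes bs: "set bs = Basis" and c: "c \<in> projective_code bs us"
  obtains f where "functional f" "c = vec (length us) (\<lambda>j. f (us ! j))"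
proof -
  let ?A = "generator_matrix bs us"
  have A: "?A \<in> carrier_mat (length bs) (length us)"
    by (simp add: generator_matrix_def)
  obtain y where y: "y \<in> carrier_vec (length bs)" "c = ?A\<^sup>T *\<^sub>v y"
    using c A unfolding projective_code_def vec_space.row_space_eq[OF A] by auto
  define f where "f v = (\<Sum>i<length bs. representation Basis v (bs ! i) * y $ i)" for v
  have "functional f"
    by unfold_locales
      (simp_all add: f_def independent_Basis span_Basis representation_add representation_scale
        sum.distrib sum_distrib_left algebra_simps)
  moreover have "c = vec (length us) (\<lambda>j. f (us ! j))"
    using y A by (intro eq_vecI)
      (auto simp: f_def generator_matrix_def scalar_prod_def bs atLeast0LessThan intro!: sum.cong)
  ultimately show thesis
    by (rule that)
qed

end

theorem theorem1p1:
  fixes scale :: "'f::{field,finite} \<Rightarrow> 'v::ab_group_add \<Rightarrow> 'v"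
    and bs :: "'v list"
    and P :: "'p set" and L :: "'p set set"
    and \<epsilon> :: "'p \<Rightarrow> 'v set"
    and vs :: "'v list"
  assumes "finite_dimensional_vector_space scale (set bs)" and "distinct bs"
    and "point_line_geometry P L"
    and "projective_space.projective_embedding scale P L \<epsilon>"
    and "\<And>H. H \<in> projective_space.pg_hyperplanes scale \<Longrightarrow>
      connected (collinearity_graph P L \<restriction> (P - {p \<in> P. \<epsilon> p \<in> H}))"
    and "projective_space.representatives scale (\<epsilon> ` P) vs"
  shows "minimal_code (length vs) (projective_space.projective_code scale bs vs)"
proof -
  interpret V: finite_dimensional_vector_space scale "set bs"
    by fact
  interpret V: finite_dimensional_projective_space scale "set bs"
    by unfold_locales
  let ?C = "V.projective_code bs vs"
  note reps = assms(6)[unfolded V.representatives_def]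
  have rep_point: "\<exists>p\<in>P. \<epsilon> p = V.span {vs ! j}" if "j < length vs" for j
  proof -
    have "V.span {vs ! j} \<in> \<epsilon> ` P"
      using reps that by (metis list.set_map imageI nth_mem)
    then show ?thesis
      by auto
  qed
  have point_rep: "\<exists>j<length vs. \<epsilon> p = V.span {vs ! j}" if "p \<in> P" for p
  proof -
    have "\<epsilon> p \<in> (\<lambda>v. V.span {v}) ` set vs"
      using reps that by simp
    then show ?thesis
      by (auto simp: in_set_conv_nth)
  qed
  have "\<exists>a. c' = a \<cdot>\<^sub>v c"
    if c: "c \<in> ?C" and c': "c' \<in> ?C" and "c \<noteq> 0\<^sub>v (length vs)" and supp: "supp c' \<subseteq> supp c" for c c'
  proof -
    obtain f where f: "V.functional f" and c_f: "c = vec (length vs) (\<lambda>j. f (vs ! j))"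
      using V.projective_code_functional[OF refl c] .
    obtain g where g: "V.functional g" and c'_g: "c' = vec (length vs) (\<lambda>j. g (vs ! j))"
      using V.projective_code_functional[OF refl c'] .
    obtain j where j: "j < length vs" "f (vs ! j) \<noteq> 0"
      using \<open>c \<noteq> 0\<^sub>v (length vs)\<close> by (auto simp: c_f vec_eq_iff)
    obtain p0 where p0: "p0 \<in> P" "vs ! j \<in> \<epsilon> p0"
      using rep_point[OF j(1)] V.span_base by blast
    have vanish: "\<forall>v\<in>\<epsilon> p. g v = 0" if p: "p \<in> P" and f0: "\<forall>v\<in>\<epsilon> p. f v = 0" for p
    proof -
      obtain i where i: "i < length vs" "\<epsilon> p = V.span {vs ! i}"
        using point_rep[OF p] by blast
      then have "f (vs ! i) = 0"
        using f0 V.span_base by blast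
      then have "g (vs ! i) = 0"
        using supp i(1) by (auto simp: supp_def c_f c'_g)
      then show ?thesis
        using V.functional_vanishing_span[OF g, of "{vs ! i}"] i(2) by auto
    qed
    obtain a where a: "\<And>p v. p \<in> P \<Longrightarrow> v \<in> \<epsilon> p \<Longrightarrow> g v = a * f v"
      using V.functionals_proportional[OF assms(3-5) f g p0 j(2) vanish] by blast
    have "g (vs ! i) = a * f (vs ! i)" if "i < length vs" for i
      using rep_point[OF that] a V.span_base by blast
    then have "c' = a \<cdot>\<^sub>v c"
      by (auto simp: c_f c'_g)
    then show ?thesis ..
  qed
  moreover have "linear_code (length vs) ?C"
    using linear_code_row_space[of "V.generator_matrix bs vs"]
    by (simp add: V.projective_code_def V.generator_matrix_def)
  ultimately show ?thesis
    by (simp add: minimal_code_def)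
qed

end
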